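(* The Nash equilibrium $x^\ast$ of the charging game takes the following form: for every $t\in[T]$, $$x^{\ast t}=\frac{d}{T}+\sum_{t'\in[T]}\frac{T\delta^{tt'}-1}{T}\left(b(\mathbf{1}_N\mathbf{1}_N^\top+I_N)+\mu\right)^{-1}\left(\mu\bar{x}^{t'}-a^{t'}\mathbf{1}_N\right),$$ where $I_N\in\mathbb{R}^{N\times N}$ is the identity matrix.
   Context: For a positive integer $m$, $[m]=\{1,\dots,m\}$; $\mathbf{1}_N\in\mathbb{R}^N$ is the all-ones vector; $\delta^{tt'}$ is the Kronecker delta; $\|\cdot\|$ is the Euclidean norm. Charging game: there are $N$ charging stations and $T$ time steps. Station $i\in[N]$ has a nominal charging profile $\bar{x}_i=(\bar{x}_i^t)_{t\in[T]}\in\mathbb{R}^T$ with total demand $d_i=\sum_{t\in[T]}\bar{x}_i^t$, and sensitivity parameter $\mu_i>0$. Its feasible set is $X_i=\{x_i\in\mathbb{R}^T:\sum_{t\in[T]}x_i^t=d_i\}$ (no sign constraints), and $X=\prod_{i\in[N]}X_i$. For a joint profile $x=(x_i^t)_{i\in[N],t\in[T]}$, write $x^t=(x_i^t)_{i\in[N]}\in\mathbb{R}^N$; similarly $\bar{x}^t=(\bar{x}_i^t)_{i\in[N]}$, and $d=(d_i)_{i\in[N]}\in\mathbb{R}^N$. The price at time $t$ is $p^t(x)=a^t+b\,\mathbf{1}_N^\top x^t$ with $a^t>0$ and $b>0$. The cost of station $i$ is $$c_i(x)=\sum_{t\in[T]}p^t(x)x_i^t+\frac{\mu_i}{2}\|x_i-\bar{x}_i\|^2.$$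 A joint profile $x^\ast\in X$ is a Nash equilibrium if $c_i(x_i^\ast,x_{-i}^\ast)\le c_i(x_i,x_{-i}^\ast)$ for every $i\in[N]$ and $x_i\in X_i$, where $x_{-i}$ denotes the profiles of stations other than $i$. Also $\mu=\mathrm{diag}(\mu_1,\dots,\mu_N)$. *)

theory Defs
  imports "HOL-Analysis.Analysis"
begin

text \<open>
  Stations are indexed by a finite type \<open>'n\<close> (\<open>N = CARD('n)\<close>) and time steps by a finite type
  \<open>'t\<close> (\<open>T = CARD('t)\<close>). A joint profile is a matrix \<open>x :: real^'t^'n\<close>: its row \<open>x $ i\<close> is the
  profile of station \<open>i\<close>, and \<open>column t x\<close> is the vector of all stations' charges at time \<open>t\<close>.
\<close>

abbreviation ones :: "real^'n"
  where "ones \<equiv> vec 1"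

definition outer_product :: "real^'n \<Rightarrow> real^'n \<Rightarrow> real^'n^'n"
  where "outer_product u v = (\<chi> i j. u $ i * v $ j)"

definition diag_matrix :: "real^'n \<Rightarrow> real^'n^'n"
  where "diag_matrix v = (\<chi> i j. if i = j then v $ i else 0)"

definition kronecker :: "'t \<Rightarrow> 't \<Rightarrow> real"
  where "kronecker t t' = (if t = t' then 1 else 0)"

definition demand :: "real^'t^'n \<Rightarrow> real^'n"
  where "demand xbar = (\<chi> i. \<Sum>t\<in>UNIV. xbar $ i $ t)"

definition feasible :: "real^'t^'n \<Rightarrow> 'n \<Rightarrow> (real^'t) set"
  where "feasible xbar i = {y. (\<Sum>t\<in>UNIV. y $ t) = demand xbar $ i}"

definition joint_feasible :: "real^'t^'n \<Rightarrow> (real^'t^'n) set"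
  where "joint_feasible xbar = {x. \<forall>i. x $ i \<in> feasible xbar i}"

definition price :: "real^'t \<Rightarrow> real \<Rightarrow> real^'t^'n \<Rightarrow> 't \<Rightarrow> real"
  where "price a b x t = a $ t + b * (ones \<bullet> column t x)"

definition cost ::
    "real^'t \<Rightarrow> real \<Rightarrow> real^'n \<Rightarrow> real^'t^'n \<Rightarrow> 'n \<Rightarrow> real^'t^'n \<Rightarrow> real"
  where "cost a b \<mu> xbar i x =
    (\<Sum>t\<in>UNIV. price a b x t * x $ i $ t) + \<mu> $ i / 2 * (norm (x $ i - xbar $ i))\<^sup>2"

definition deviate :: "real^'t^'n \<Rightarrow> 'n \<Rightarrow> real^'t \<Rightarrow> real^'t^'n"
  where "deviate x i y = (\<chi> j. if j = i then y else x $ j)"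

definition nash_equilibrium ::
    "real^'t \<Rightarrow> real \<Rightarrow> real^'n \<Rightarrow> real^'t^'n \<Rightarrow> real^'t^'n \<Rightarrow> bool"
  where "nash_equilibrium a b \<mu> xbar x \<longleftrightarrow>
    x \<in> joint_feasible xbar \<and>
    (\<forall>i. \<forall>y\<in>feasible xbar i. cost a b \<mu> xbar i x \<le> cost a b \<mu> xbar i (deviate x i y))"

end

theory Submission imports Defs begin

text \<open>
  Fix the other stations. A deviation of station \<open>i\<close> by \<open>h\<close> changes its cost by an exact quadratic
  \<open>g \<bullet> h + (b + \<mu>\<^sub>i / 2) (h \<bullet> h)\<close>, where \<open>g\<close> is the marginal cost of the station at the current
  profile (\<open>cost_deviate\<close>), and it preserves the demand constraint exactly when the entries of \<open>h\<close>
  sum to zero. Such a quadratic is nonnegative on that hyperplane if and only if \<open>g\<close> is constant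
  in time (\<open>quadratic_nonneg_on_sum_zero_iff\<close>). So the equilibria are the feasible profiles at
  which every station has equalised its marginal cost over time.

  Stacking the stations, the marginal costs at time \<open>t\<close> form the vector
  \<open>M x\<^sup>t - (\<mu> xbar\<^sup>t - a\<^sup>t 1)\<close> with the single, time-independent matrix
  \<open>M = b (1 1\<^sup>T + I) + \<mu>\<close>. This matrix is positive definite, hence invertible, and an equilibrium
  is a feasible profile with \<open>x\<^sup>t = M\<^sup>-\<^sup>1 (\<mu> xbar\<^sup>t - a\<^sup>t 1) + c\<close> for a vector \<open>c\<close> independent of
  \<open>t\<close>. Summing over time determines \<open>c\<close> from the demand, which gives the closed form
  (\<open>prescribed_sum_translate_iff\<close>).
\<close>

text \<open>
  The nontrivial direction tests the quadratic at \<open>-s w\<close>, where \<open>w\<close> is the orthogonal projection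
  of \<open>g\<close> on the sum-zero hyperplane: this yields \<open>(k s\<^sup>2 - s) (w \<bullet> w) \<ge> 0\<close>, and a small step \<open>s\<close>
  makes the first factor negative.
\<close>

lemma quadratic_nonneg_on_sum_zero_iff:
  fixes g :: "real^'t" and k :: real
  assumes "k > 0"
  shows "(\<forall>h::real^'t. (\<Sum>t\<in>UNIV. h $ t) = 0 \<longrightarrow> 0 \<le> g \<bullet> h + k * (h \<bullet> h)) \<longleftrightarrow>
    (\<exists>c. \<forall>t. g $ t = c)"
proof
  assume nonneg: "\<forall>h::real^'t. (\<Sum>t\<in>UNIV. h $ t) = 0 \<longrightarrow> 0 \<le> g \<bullet> h + k * (h \<bullet> h)"
  define m where "m = (\<Sum>t\<in>UNIV. g $ t) / real CARD('t)"
  define w where "w = g - vec m"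
  have sum_w: "(\<Sum>t\<in>UNIV. w $ t) = 0"
    by (simp add: w_def m_def sum_subtractf)
  have "vec m \<bullet> w = m * (\<Sum>t\<in>UNIV. w $ t)"
    by (simp add: inner_vec_def sum_distrib_left)
  then have gw: "g \<bullet> w = w \<bullet> w"
    using sum_w by (simp add: w_def inner_diff_left)
  \<comment> \<open>The step \<open>1 / (2 k)\<close> minimises \<open>k s\<^sup>2 - s\<close>; the minimum is \<open>-1 / (4 k)\<close>.\<close>
  define s where "s = 1 / (2 * k)"
  have "(\<Sum>t\<in>UNIV. (- s *\<^sub>R w) $ t) = 0"
    using sum_w by (simp add: sum_negf flip: sum_distrib_left)
  then have "0 \<le> g \<bullet> (- s *\<^sub>R w) + k * ((- s *\<^sub>R w) \<bullet> (- s *\<^sub>R w))"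
    using nonneg by blast
  also have "\<dots> = - (w \<bullet> w) / (4 * k)"
    using assms gw by (simp add: s_def field_simps)
  finally have "w \<bullet> w \<le> 0"
    using assms by (simp add: field_simps)
  then have "w = 0"
    using inner_ge_zero[of w] by (metis inner_eq_zero_iff order_antisym)
  then have "g = vec m"
    by (simp add: w_def)
  then show "\<exists>c. \<forall>t. g $ t = c"
    by simp
next
  assume "\<exists>c. \<forall>t. g $ t = c"
  then obtain c where c: "\<And>t. g $ t = c"
    by blast
  show "\<forall>h::real^'t. (\<Sum>t\<in>UNIV. h $ t) = 0 \<longrightarrow> 0 \<le> g \<bullet> h + k * (h \<bullet> h)"
  proof (intro allI impI)
    fix h :: "real^'t"
    assume "(\<Sum>t\<in>UNIV. h $ t) = 0"
    then have "g \<bullet> h = 0"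
      by (simp add: inner_vec_def c flip: sum_distrib_left)
    then show "0 \<le> g \<bullet> h + k * (h \<bullet> h)"
      using assms by simp
  qed
qed

text \<open>
  The term \<open>b x\<^sub>i\<^sup>t\<close> is the effect of the station's own charge on the price it pays.
\<close>

definition marginal_cost ::
    "real^'t \<Rightarrow> real \<Rightarrow> real^'n \<Rightarrow> real^'t^'n \<Rightarrow> real^'t^'n \<Rightarrow> 'n \<Rightarrow> real^'t"
  where "marginal_cost a b \<mu> xbar x i =
    (\<chi> t. price a b x t + b * x $ i $ t + \<mu> $ i * (x $ i $ t - xbar $ i $ t))"

lemma price_deviate:
  "price a b (deviate x i y) t = price a b x t + b * (y $ t - x $ i $ t)"
proof -
  have "(\<Sum>j\<in>UNIV. deviate x i y $ j $ t) - (\<Sum>j\<in>UNIV. x $ j $ t)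
      = (\<Sum>j\<in>UNIV. if j = i then y $ t - x $ i $ t else 0)"
    unfolding sum_subtractf[symmetric] by (rule sum.cong) (auto simp: deviate_def)
  then have "(\<Sum>j\<in>UNIV. deviate x i y $ j $ t) = (\<Sum>j\<in>UNIV. x $ j $ t) + (y $ t - x $ i $ t)"
    by simp
  then show ?thesis
    by (simp add: price_def inner_vec_def column_def ring_distribs)
qed

text \<open>
  The expansion is exact because the cost is quadratic in the station's own profile. The price
  contributes \<open>b\<close> to the curvature and the discomfort term \<open>\<mu>\<^sub>i / 2\<close>.
\<close>

lemma cost_deviate:
  "cost a b \<mu> xbar i (deviate x i (x $ i + h)) =
    cost a b \<mu> xbar i x + marginal_cost a b \<mu> xbar x i \<bullet> h + (b + \<mu> $ i / 2) * (h \<bullet> h)"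
proof -
  have cost_sum: "cost a b \<mu> xbar i z =
      (\<Sum>t\<in>UNIV. price a b z t * z $ i $ t + \<mu> $ i / 2 * (z $ i $ t - xbar $ i $ t)\<^sup>2)" for z
    unfolding cost_def power2_norm_eq_inner
    by (simp add: inner_vec_def sum.distrib sum_distrib_left power2_eq_square)
  have dev: "deviate x i y $ i = y" for y
    by (simp add: deviate_def)
  show ?thesis
    unfolding cost_sum dev price_deviate marginal_cost_def inner_vec_def sum_distrib_left
      sum.distrib[symmetric]
    by (rule sum.cong) (simp_all add: field_simps power2_eq_square)
qed

lemma nash_equilibrium_iff_marginal_cost_constant:
  fixes a :: "real^'t" and \<mu> :: "real^'n"
  assumes "b > 0" and "\<And>i. \<mu> $ i > 0"
  shows "nash_equilibrium a b \<mu> xbar x \<longleftrightarrow>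
    x \<in> joint_feasible xbar \<and> (\<forall>i. \<exists>c. \<forall>t. marginal_cost a b \<mu> xbar x i $ t = c)"
proof -
  have "(\<forall>y\<in>feasible xbar i. cost a b \<mu> xbar i x \<le> cost a b \<mu> xbar i (deviate x i y)) \<longleftrightarrow>
      (\<exists>c. \<forall>t. marginal_cost a b \<mu> xbar x i $ t = c)" (is "?best \<longleftrightarrow> _")
    if feas: "x \<in> joint_feasible xbar" for i
  proof -
    have own: "(\<Sum>t\<in>UNIV. x $ i $ t) = demand xbar $ i"
      using feas by (simp add: joint_feasible_def feasible_def)
    have "?best \<longleftrightarrow> (\<forall>h. x $ i + h \<in> feasible xbar i \<longrightarrow>
        cost a b \<mu> xbar i x \<le> cost a b \<mu> xbar i (deviate x i (x $ i + h)))"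
      by (metis add_diff_cancel_left' diff_add_cancel add.commute)
    also have "\<dots> \<longleftrightarrow> (\<forall>h. (\<Sum>t\<in>UNIV. h $ t) = 0 \<longrightarrow>
        0 \<le> marginal_cost a b \<mu> xbar x i \<bullet> h + (b + \<mu> $ i / 2) * (h \<bullet> h))"
      using own by (simp add: cost_deviate feasible_def sum.distrib add.assoc)
    also have "\<dots> \<longleftrightarrow> (\<exists>c. \<forall>t. marginal_cost a b \<mu> xbar x i $ t = c)"
      using assms by (intro quadratic_nonneg_on_sum_zero_iff) (simp add: add_pos_pos)
    finally show ?thesis .
  qed
  then show ?thesis
    unfolding nash_equilibrium_def by blast
qed

definition game_matrix :: "real \<Rightarrow> real^'n \<Rightarrow> real^'n^'n"
  where "game_matrix b \<mu> = b *\<^sub>R (outer_product ones ones + mat 1) + diag_matrix \<mu>"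

lemma diag_matrix_mult_vector: "(diag_matrix v *v u) $ i = v $ i * u $ i"
  by (simp add: diag_matrix_def matrix_vector_mult_def if_distrib[of "\<lambda>z. z * _"] cong: if_cong)

lemma game_matrix_mult_vector:
  "(game_matrix b \<mu> *v v) $ i = b * (ones \<bullet> v) + (b + \<mu> $ i) * v $ i"
proof -
  have "(outer_product ones ones *v v) $ i = ones \<bullet> v"
    by (simp add: outer_product_def matrix_vector_mult_def inner_vec_def)
  then show ?thesis
    by (simp add: game_matrix_def matrix_vector_mult_add_rdistrib diag_matrix_mult_vector
        scaleR_matrix_vector_assoc[symmetric] algebra_simps)
qed

text \<open>
  The quadratic form of the matrix is \<open>b (\<Sum>\<^sub>i v\<^sub>i)\<^sup>2 + \<Sum>\<^sub>i (b + \<mu>\<^sub>i) v\<^sub>i\<^sup>2\<close>, which forces the kernel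
  to be trivial.
\<close>

lemma invertible_game_matrix:
  fixes \<mu> :: "real^'n"
  assumes "b > 0" and "\<And>i. \<mu> $ i > 0"
  shows "invertible (game_matrix b \<mu>)"
proof -
  have "v = 0" if ker: "game_matrix b \<mu> *v v = 0" for v :: "real^'n"
  proof -
    have pos: "0 \<le> (b + \<mu> $ i) * (v $ i)\<^sup>2" for i
      using assms by (simp add: add_nonneg_nonneg less_imp_le)
    have "0 = v \<bullet> (game_matrix b \<mu> *v v)"
      using ker by simp
    also have "\<dots> = (\<Sum>i\<in>UNIV. v $ i * (b * (ones \<bullet> v)) + (b + \<mu> $ i) * (v $ i)\<^sup>2)"
      unfolding inner_vec_def[of v "game_matrix b \<mu> *v v"] game_matrix_mult_vector
      by (simp add: algebra_simps power2_eq_square)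
    also have "\<dots> = b * (ones \<bullet> v)\<^sup>2 + (\<Sum>i\<in>UNIV. (b + \<mu> $ i) * (v $ i)\<^sup>2)"
      by (simp add: sum.distrib inner_vec_def power2_eq_square flip: sum_distrib_right)
    finally have "(\<Sum>i\<in>UNIV. (b + \<mu> $ i) * (v $ i)\<^sup>2) \<le> 0"
      using assms(1) by (smt (verit) mult_nonneg_nonneg zero_le_power2)
    then have "(\<Sum>i\<in>UNIV. (b + \<mu> $ i) * (v $ i)\<^sup>2) = 0"
      by (intro order_antisym sum_nonneg pos)
    then have "(b + \<mu> $ i) * (v $ i)\<^sup>2 = 0" for i
      using pos by (simp add: sum_nonneg_eq_0_iff)
    moreover have "b + \<mu> $ i \<noteq> 0" for i
      using assms(1) assms(2)[of i] by simp
    ultimately show "v = 0"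
      by (simp add: vec_eq_iff)
  qed
  then show ?thesis
    by (simp add: invertible_left_inverse matrix_left_invertible_ker)
qed

lemma marginal_cost_eq_game_matrix:
  "marginal_cost a b \<mu> xbar x i $ t =
    (game_matrix b \<mu> *v column t x - (diag_matrix \<mu> *v column t xbar - a $ t *\<^sub>R ones)) $ i"
  by (simp add: marginal_cost_def price_def game_matrix_mult_vector diag_matrix_mult_vector
      column_def algebra_simps)

lemma invertible_mult_vector_eq_iff:
  fixes A :: "real^'n^'n"
  assumes "invertible A"
  shows "A *v u = v \<longleftrightarrow> u = matrix_inv A *v v"
proof -
  have "A ** matrix_inv A = mat 1 \<and> matrix_inv A ** A = mat 1"
    using assms unfolding invertible_def matrix_inv_def by (rule someI_ex)
  then show ?thesis
    by (metis matrix_vector_mul_assoc matrix_vector_mul_lid)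
qed

text \<open>
  A feasible translate \<open>q t + c\<close> has \<open>c = (d - \<Sum>\<^sub>t q t) / T\<close>, and the Kronecker coefficients are
  those of \<open>q t - (\<Sum>\<^sub>t q t) / T\<close>.
\<close>

lemma prescribed_sum_translate_iff:
  fixes z q :: "'t::finite \<Rightarrow> 'v::real_vector"
  shows "(\<Sum>t\<in>UNIV. z t) = d \<and> (\<exists>c. \<forall>t. z t = q t + c) \<longleftrightarrow>
    (\<forall>t. z t = (1 / real CARD('t)) *\<^sub>R d +
      (\<Sum>t'\<in>UNIV. ((real CARD('t) * kronecker t t' - 1) / real CARD('t)) *\<^sub>R q t'))"
proof -
  define T where "T = real CARD('t)"
  have T: "T \<noteq> 0"
    by (simp add: T_def)
  have coeff: "(\<Sum>t'\<in>UNIV. ((T * kronecker t t' - 1) / T) *\<^sub>R q t') =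
      q t - (1 / T) *\<^sub>R (\<Sum>t'\<in>UNIV. q t')" for t
  proof -
    have "((T * kronecker t t' - 1) / T) *\<^sub>R q t' =
        (if t = t' then q t' else 0) - (1 / T) *\<^sub>R q t'" for t'
      using T by (simp add: kronecker_def diff_divide_distrib scaleR_diff_left)
    then show ?thesis
      by (simp add: sum_subtractf scaleR_sum_right)
  qed
  have const: "(\<Sum>t\<in>(UNIV::'t set). e) = T *\<^sub>R e" for e :: 'v
    by (simp add: T_def sum_constant_scaleR)
  have "(\<Sum>t\<in>UNIV. z t) = d \<and> (\<exists>c. \<forall>t. z t = q t + c) \<longleftrightarrow>
    (\<forall>t. z t = (1 / T) *\<^sub>R d + (q t - (1 / T) *\<^sub>R (\<Sum>t'\<in>UNIV. q t')))" (is "?l \<longleftrightarrow> ?r")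
  proof
    assume ?l
    then obtain c where c: "\<And>t. z t = q t + c" and d: "(\<Sum>t\<in>UNIV. z t) = d"
      by blast
    have "d = (\<Sum>t\<in>UNIV. q t) + T *\<^sub>R c"
      using d by (simp add: c sum.distrib const)
    then show ?r
      using T by (simp add: c scaleR_add_right)
  next
    assume r: ?r
    have "(\<Sum>t\<in>UNIV. z t) = d"
      using T r by (simp add: sum.distrib sum_subtractf const)
    moreover have "\<forall>t. z t = q t + ((1 / T) *\<^sub>R d - (1 / T) *\<^sub>R (\<Sum>t'\<in>UNIV. q t'))"
      using r by simp
    ultimately show ?l
      by blast
  qed
  then show ?thesis
    unfolding T_def[symmetric] coeff .
qed

theorem corollary1:
  fixes a :: "real^'t" and b :: real and \<mu> :: "real^'n" and xbar x :: "real^'t^'n"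
  assumes "\<And>t. a $ t > 0" and "b > 0" and "\<And>i. \<mu> $ i > 0"
  shows "nash_equilibrium a b \<mu> xbar x \<longleftrightarrow>
    (\<forall>t. column t x =
      (1 / real CARD('t)) *\<^sub>R demand xbar +
      (\<Sum>t'\<in>UNIV. ((real CARD('t) * kronecker t t' - 1) / real CARD('t)) *\<^sub>R
        (matrix_inv (b *\<^sub>R (outer_product ones ones + mat 1) + diag_matrix \<mu>) *v
          (diag_matrix \<mu> *v column t' xbar - a $ t' *\<^sub>R ones))))"
proof -
  define M where "M = game_matrix b \<mu>"
  define r where "r t = diag_matrix \<mu> *v column t xbar - a $ t *\<^sub>R ones" for t
  have inv: "invertible M"
    unfolding M_def using assms(2,3) by (rule invertible_game_matrix)
  have feasible_iff: "x \<in> joint_feasible xbar \<longleftrightarrow> (\<Sum>t\<in>UNIV. column t x) = demand xbar"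
    by (simp add: joint_feasible_def feasible_def vec_eq_iff column_def)
  have "(\<forall>i. \<exists>c. \<forall>t. marginal_cost a b \<mu> xbar x i $ t = c) \<longleftrightarrow>
      (\<exists>c. \<forall>t. M *v column t x - r t = c)"
    unfolding marginal_cost_eq_game_matrix M_def[symmetric] r_def[symmetric] vec_eq_iff
      choice_iff
    by (metis vec_lambda_beta)
  also have "\<dots> \<longleftrightarrow> (\<exists>c. \<forall>t. M *v column t x = r t + c)"
    by (simp add: diff_eq_eq add.commute)
  also have "\<dots> \<longleftrightarrow> (\<exists>c. \<forall>t. column t x = matrix_inv M *v r t + matrix_inv M *v c)"
    by (simp add: invertible_mult_vector_eq_iff[OF inv] matrix_vector_right_distrib)
  \<comment> \<open>As \<open>M\<close> is invertible, its inverse maps onto every possible shift.\<close>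
  also have "\<dots> \<longleftrightarrow> (\<exists>c. \<forall>t. column t x = matrix_inv M *v r t + c)"
    using invertible_mult_vector_eq_iff[OF inv] by metis
  finally have "nash_equilibrium a b \<mu> xbar x \<longleftrightarrow>
      (\<Sum>t\<in>UNIV. column t x) = demand xbar \<and>
      (\<exists>c. \<forall>t. column t x = matrix_inv M *v r t + c)"
    using nash_equilibrium_iff_marginal_cost_constant[of b \<mu> a xbar x] assms(2,3) feasible_iff
    by simp
  then show ?thesis
    unfolding prescribed_sum_translate_iff M_def game_matrix_def r_def .
qed

end
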